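(* The $(2,-1)$-bidifferential $$\Psi(x,y)=-\frac{\omega(x,y)\begin{vmatrix}\boldsymbol\nu(x)\\\boldsymbol\nu(y)\end{vmatrix}+\begin{vmatrix}\boldsymbol\nu(y)\\\nabla_x\boldsymbol\nu(y)\end{vmatrix}}{\begin{vmatrix}\boldsymbol\nu(y)\\\partial_y\boldsymbol\nu(y)\end{vmatrix}dy}$$ on a genus two Riemann surface is $\mathrm{Sp}(4,\mathbb Z)$ modular invariant; that is, for every $\gamma\in\mathrm{Sp}(4,\mathbb Z)$, the expression $\Psi^\gamma(x,y)$ obtained by replacing $\omega,\boldsymbol\nu,\nabla_x$ by $\omega^\gamma,\boldsymbol\nu^\gamma,\nabla_x^\gamma$ satisfies $\Psi^\gamma(x,y)=\Psi(x,y)$.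
   Context: On a compact genus two Riemann surface with canonical homology basis $\alpha^i,\beta^i$ ($i=1,2$), $\omega(x,y)$ is the unique symmetric bidifferential, holomorphic for $x\ne y$, with $\omega(x,y)=\left(\frac1{(x-y)^2}+\text{regular}\right)dx\,dy$ in local coordinates and $\oint_{\alpha^i}\omega(x,\cdot)=0$. $\nu_i(x)=\oint_{\beta^i}\omega(x,\cdot)$ are the holomorphic 1-differentials, normalised by $\oint_{\alpha^i}\nu_j=2\pi i\delta_{ij}$; $\boldsymbol\nu(x)=[\nu_1(x),\nu_2(x)]$ is a row vector; $\Omega_{ij}=\frac1{2\pi i}\oint_{\beta^i}\nu_j$ is the period matrix in the Siegel upper half plane $\mathbb H_2$. Vertical bars denote $2\times2$ determinants. The operator $$\nabla_x=\sum_{1\le a\le b\le2}\nu_a(x)\nu_b(x)\frac{\partial}{\partial\Omega_{ab}}$$ uses the independent coordinates $\Omega_{11},\Omega_{12},\Omega_{22}$; in $\nabla_x\boldsymbol\nu(y)$ the derivative in $\Omega$ acts on the coefficient of $\boldsymbol\nu(y)$ with the local coordinate $y$ held fixed. $\mathrm{Sp}(4,\mathbb Z)$ consists of integral matrices $\gamma=\begin{bmatrix}A&B\\C&D\end{bmatrix}$ ($2\times2$ blocks) with $A^TD-C^TB=I$, $AB^T=BA^T$, $CD^T=DC^T$, $A^TC=C^TA$, $B^TD=D^TB$. With $M=C\Omega+D$ and $N=M^{-1}$, the transformations under $\gamma$ are $$\boldsymbol\nu^\gamma(x)=\boldsymbol\nu(x)N,\quad\Omega^\gamma=(A\Omega+B)N,\quad\nabla_x^\gamma=\nabla_x,$$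 $$\omega^\gamma(x,y)=\omega(x,y)-\tfrac12\sum_{1\le a\le b\le2}(\nu_a(x)\nu_b(y)+\nu_b(x)\nu_a(y))\frac{\partial}{\partial\Omega_{ab}}\log\det M.$$ *)

theory Defs
  imports "HOL-Complex_Analysis.Complex_Analysis" "HOL-Homology.Homology"
begin

subsection \<open>Symmetric matrices and the Siegel upper half plane\<close>

definition sym_mats :: "(complex^2^2) set" where
  "sym_mats = {Z. transpose Z = Z}"

definition siegel2 :: "(complex^2^2) set" where
  "siegel2 = {Z \<in> sym_mats. \<forall>v::real^2. v \<noteq> 0 \<longrightarrow> 0 < v \<bullet> (map_matrix Im Z *v v)}"

text \<open>The partial derivative of \<open>f\<close> with respect to \<open>\<Omega>\<^sub>a\<^sub>b\<close>, where \<open>\<Omega>\<^sub>1\<^sub>1, \<Omega>\<^sub>1\<^sub>2, \<Omega>\<^sub>2\<^sub>2\<close> are the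
  independent coordinates on the symmetric matrices: for \<open>a \<noteq> b\<close> both off-diagonal entries move.\<close>

definition pderiv_Omega :: "2 \<Rightarrow> 2 \<Rightarrow> (complex^2^2 \<Rightarrow> complex) \<Rightarrow> complex^2^2 \<Rightarrow> complex" where
  "pderiv_Omega a b f Z =
     deriv (\<lambda>h. f (\<chi> i j. if {i, j} = {a, b} then Z $ i $ j + h else Z $ i $ j)) 0"

text \<open>The pairs \<open>(a, b)\<close> with \<open>1 \<le> a \<le> b \<le> 2\<close>.  They are listed explicitly because in the numeral
  type \<open>2\<close> the equation \<open>2 = 0\<close> holds, so that its library order is not the intended one.\<close>

definition ordered_pairs :: "(2 \<times> 2) set" where
  "ordered_pairs = {(1, 1), (1, 2), (2, 2)}"

text \<open>Holomorphy in several variables: the Frechet derivative exists and is complex linear.  In the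
  first definition the variables are \<open>\<Omega>\<^sub>1\<^sub>1, \<Omega>\<^sub>1\<^sub>2, \<Omega>\<^sub>2\<^sub>2\<close> and a fibre coordinate, and \<open>S\<close> is meant
  to be relatively open in \<open>sym_mats \<times> UNIV\<close>.\<close>

definition holomorphic_sym_on :: "((complex^2^2) \<times> complex \<Rightarrow> complex) \<Rightarrow> ((complex^2^2) \<times> complex) set \<Rightarrow> bool" where
  "holomorphic_sym_on f S \<longleftrightarrow>
     (\<forall>w\<in>S. \<exists>(a::complex^2^2) b.
        (f has_derivative (\<lambda>(H, k). (\<Sum>i\<in>UNIV. \<Sum>j\<in>UNIV. a $ i $ j * H $ i $ j) + b * k))
          (at w within sym_mats \<times> UNIV))"

definition holomorphic2_on :: "(complex \<times> complex \<Rightarrow> complex) \<Rightarrow> (complex \<times> complex) set \<Rightarrow> bool" where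
  "holomorphic2_on f S \<longleftrightarrow>
     (\<forall>w\<in>S. \<exists>a b. (f has_derivative (\<lambda>(h, k). a * h + b * k)) (at w))"


subsection \<open>Holomorphic families of compact genus two Riemann surfaces\<close>

text \<open>A family of surfaces over an open set of period matrices \<open>\<Omega>\<close> is given by a total space and a
  projection.  A chart \<open>(V, z)\<close> of the total space consists of an open set \<open>V\<close> and a fibre
  coordinate \<open>z\<close>; together with \<open>\<Omega>\<close> it yields coordinates \<open>(\<Omega>, z)\<close> on \<open>V\<close>.  Restricted to a
  fibre, \<open>z\<close> is a local coordinate of the Riemann surface with period matrix \<open>\<Omega>\<close>, and ``the
  derivative in \<open>\<Omega>\<close> with the local coordinate held fixed'' has a meaning.\<close>

type_synonym 'a chart = "'a set \<times> ('a \<Rightarrow> complex)"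

record 'a surface_family =
  total_space :: "'a topology"
  base :: "(complex^2^2) set"
  proj :: "'a \<Rightarrow> complex^2^2"
  charts :: "'a chart set"

definition fibre :: "'a surface_family \<Rightarrow> complex^2^2 \<Rightarrow> 'a topology" where
  "fibre X \<Omega> = subtopology (total_space X) {p. proj X p = \<Omega>}"

definition coords :: "'a surface_family \<Rightarrow> 'a chart \<Rightarrow> 'a \<Rightarrow> (complex^2^2) \<times> complex" where
  "coords X c p = (proj X p, snd c p)"

definition chart_pt :: "'a surface_family \<Rightarrow> 'a chart \<Rightarrow> (complex^2^2) \<times> complex \<Rightarrow> 'a" where
  "chart_pt X c = inv_into (fst c) (coords X c)"

text \<open>The coordinate vector fields of the coordinates \<open>(\<Omega>, z)\<close> of a chart.\<close>

definition d_Omega ::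
    "'a surface_family \<Rightarrow> 'a chart \<Rightarrow> 2 \<Rightarrow> 2 \<Rightarrow> ('a \<Rightarrow> complex) \<Rightarrow> 'a \<Rightarrow> complex" where
  "d_Omega X c a b f p = pderiv_Omega a b (\<lambda>Z. f (chart_pt X c (Z, snd c p))) (proj X p)"

definition d_coord :: "'a surface_family \<Rightarrow> 'a chart \<Rightarrow> ('a \<Rightarrow> complex) \<Rightarrow> 'a \<Rightarrow> complex" where
  "d_coord X c f p = deriv (\<lambda>s. f (chart_pt X c (proj X p, s))) (snd c p)"

text \<open>Genus two is expressed by the first homology group of the fibre being free abelian of rank 4.\<close>

definition genus2_family :: "'a surface_family \<Rightarrow> bool" where
  "genus2_family X \<longleftrightarrow>
     openin (top_of_set sym_mats) (base X) \<and> base X \<subseteq> siegel2 \<and>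
     Hausdorff_space (total_space X) \<and>
     continuous_map (total_space X) (top_of_set (base X)) (proj X) \<and>
     (\<forall>c\<in>charts X.
        openin (total_space X) (fst c) \<and>
        openin (top_of_set (sym_mats \<times> UNIV)) (coords X c ` fst c) \<and>
        homeomorphic_map (subtopology (total_space X) (fst c)) (top_of_set (coords X c ` fst c))
          (coords X c)) \<and>
     (\<Union>c\<in>charts X. fst c) = topspace (total_space X) \<and>
     (\<forall>c\<in>charts X. \<forall>d\<in>charts X.
        holomorphic_sym_on (\<lambda>w. snd d (chart_pt X c w)) (coords X c ` (fst c \<inter> fst d))) \<and>
     (\<forall>\<Omega>\<in>base X.
        compact_space (fibre X \<Omega>) \<and> connected_space (fibre X \<Omega>) \<and>
        homology_group 1 (fibre X \<Omega>) \<cong> free_Abelian_group {0..<4::nat})"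


subsection \<open>Canonical homology bases and contour integrals\<close>

text \<open>Closed curves are parametrised by 1-periodic functions of a real variable.\<close>

definition simple_smooth_loop :: "'a surface_family \<Rightarrow> complex^2^2 \<Rightarrow> (real \<Rightarrow> 'a) \<Rightarrow> bool" where
  "simple_smooth_loop X \<Omega> g \<longleftrightarrow>
     (\<forall>t. g (t + 1) = g t) \<and> inj_on g {0..<1} \<and>
     continuous_map euclideanreal (fibre X \<Omega>) g \<and>
     (\<forall>c\<in>charts X.
        (snd c \<circ> g) C1_differentiable_on {t. g t \<in> fst c} \<and>
        (\<forall>t. g t \<in> fst c \<longrightarrow> vector_derivative (snd c \<circ> g) (at t) \<noteq> 0))"

text \<open>A canonical homology basis \<open>\<alpha>\<^sup>i, \<beta>\<^sup>i\<close> is represented by simple loops with the intersection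
  numbers \<open>\<alpha>\<^sup>i \<cdot> \<beta>\<^sup>j = \<delta>\<^sub>i\<^sub>j\<close>, \<open>\<alpha>\<^sup>i \<cdot> \<alpha>\<^sup>j = \<beta>\<^sup>i \<cdot> \<beta>\<^sup>j = 0\<close> realised geometrically: \<open>\<alpha>\<^sup>i\<close> and \<open>\<beta>\<^sup>i\<close>
  cross transversally in one point, their tangents being positively oriented there, and there are
  no other intersections.  The intersection matrix being unimodular, such loops form a basis of the
  first homology group of a genus two surface.\<close>

definition canonical_basis ::
    "'a surface_family \<Rightarrow> complex^2^2 \<Rightarrow> (2 \<Rightarrow> real \<Rightarrow> 'a) \<Rightarrow> (2 \<Rightarrow> real \<Rightarrow> 'a) \<Rightarrow> bool" where
  "canonical_basis X \<Omega> \<alpha> \<beta> \<longleftrightarrow>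
     (\<forall>i. simple_smooth_loop X \<Omega> (\<alpha> i) \<and> simple_smooth_loop X \<Omega> (\<beta> i)) \<and>
     (\<forall>i j. i \<noteq> j \<longrightarrow>
        range (\<alpha> i) \<inter> range (\<alpha> j) = {} \<and> range (\<beta> i) \<inter> range (\<beta> j) = {} \<and>
        range (\<alpha> i) \<inter> range (\<beta> j) = {}) \<and>
     (\<forall>i. \<exists>s t. \<alpha> i s = \<beta> i t \<and> range (\<alpha> i) \<inter> range (\<beta> i) = {\<alpha> i s} \<and>
        (\<forall>c\<in>charts X. \<alpha> i s \<in> fst c \<longrightarrow>
           0 < Im (vector_derivative (snd c \<circ> \<beta> i) (at t) *
                   cnj (vector_derivative (snd c \<circ> \<alpha> i) (at s)))))"

text \<open>A canonical homology basis of every fibre, varying continuously with \<open>\<Omega>\<close>.\<close>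

definition marking ::
    "'a surface_family \<Rightarrow> (complex^2^2 \<Rightarrow> 2 \<Rightarrow> real \<Rightarrow> 'a) \<Rightarrow> (complex^2^2 \<Rightarrow> 2 \<Rightarrow> real \<Rightarrow> 'a) \<Rightarrow> bool" where
  "marking X \<alpha> \<beta> \<longleftrightarrow>
     (\<forall>\<Omega>\<in>base X. canonical_basis X \<Omega> (\<alpha> \<Omega>) (\<beta> \<Omega>)) \<and>
     (\<forall>i. continuous_map (prod_topology (top_of_set (base X)) euclideanreal) (total_space X)
            (\<lambda>(\<Omega>, t). \<alpha> \<Omega> i t) \<and>
          continuous_map (prod_topology (top_of_set (base X)) euclideanreal) (total_space X)
            (\<lambda>(\<Omega>, t). \<beta> \<Omega> i t))"

text \<open>A 1-differential (along the fibres) is a function \<open>\<eta>\<close> whose value \<open>\<eta> c p\<close> is the coefficient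
  of \<open>dz\<close> at \<open>p\<close> for a chart \<open>c = (V, z)\<close> with \<open>p \<in> V\<close>; the value for \<open>p \<notin> V\<close> is irrelevant.
  Bidifferentials and the expression \<open>\<Psi>\<close> below are treated in the same way, with one chart for
  each of the two points.\<close>

definition loop_integral :: "'a surface_family \<Rightarrow> ('a chart \<Rightarrow> 'a \<Rightarrow> complex) \<Rightarrow> (real \<Rightarrow> 'a) \<Rightarrow> complex" where
  "loop_integral X \<eta> g =
     integral {0..1} (\<lambda>t. let c = (SOME c. c \<in> charts X \<and> g t \<in> fst c)
                           in \<eta> c (g t) * vector_derivative (snd c \<circ> g) (at t))"


subsection \<open>The bidifferential \<open>\<omega>\<close>, the differentials \<open>\<nu>\<close> and the period matrix\<close>

definition transition_deriv :: "'a surface_family \<Rightarrow> 'a chart \<Rightarrow> 'a chart \<Rightarrow> 'a \<Rightarrow> complex" where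
  "transition_deriv X c d p = d_coord X c (snd d) p"

type_synonym 'a bidifferential = "'a chart \<Rightarrow> 'a chart \<Rightarrow> 'a \<Rightarrow> 'a \<Rightarrow> complex"

definition normalised_bidifferential ::
    "'a surface_family \<Rightarrow> (complex^2^2 \<Rightarrow> 2 \<Rightarrow> real \<Rightarrow> 'a) \<Rightarrow> 'a bidifferential \<Rightarrow> bool" where
  "normalised_bidifferential X \<alpha> \<omega> \<longleftrightarrow>
     \<comment> \<open>transformation law\<close>
     (\<forall>c\<in>charts X. \<forall>c'\<in>charts X. \<forall>d\<in>charts X. \<forall>d'\<in>charts X.
        \<forall>p\<in>fst c \<inter> fst c'. \<forall>q\<in>fst d \<inter> fst d'. proj X p = proj X q \<and> p \<noteq> q \<longrightarrow>
          \<omega> c d p q = \<omega> c' d' p q * transition_deriv X c c' p * transition_deriv X d d' q) \<and>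
     \<comment> \<open>symmetry\<close>
     (\<forall>c\<in>charts X. \<forall>d\<in>charts X. \<forall>p\<in>fst c. \<forall>q\<in>fst d. proj X p = proj X q \<and> p \<noteq> q \<longrightarrow>
        \<omega> c d p q = \<omega> d c q p) \<and>
     \<comment> \<open>holomorphic off the diagonal\<close>
     (\<forall>\<Omega>\<in>base X. \<forall>c\<in>charts X. \<forall>d\<in>charts X.
        holomorphic2_on (\<lambda>(s, t). \<omega> c d (chart_pt X c (\<Omega>, s)) (chart_pt X d (\<Omega>, t)))
          {(s, t). (\<Omega>, s) \<in> coords X c ` fst c \<and> (\<Omega>, t) \<in> coords X d ` fst d \<and>
                   chart_pt X c (\<Omega>, s) \<noteq> chart_pt X d (\<Omega>, t)}) \<and>
     \<comment> \<open>double pole on the diagonal\<close>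
     (\<forall>\<Omega>\<in>base X. \<forall>c\<in>charts X. \<exists>R.
        let S = {s. (\<Omega>, s) \<in> coords X c ` fst c} in
        holomorphic2_on R (S \<times> S) \<and>
        (\<forall>s\<in>S. \<forall>t\<in>S. s \<noteq> t \<longrightarrow>
           \<omega> c c (chart_pt X c (\<Omega>, s)) (chart_pt X c (\<Omega>, t)) = 1 / (s - t)\<^sup>2 + R (s, t))) \<and>
     \<comment> \<open>vanishing \<open>\<alpha>\<close>-periods\<close>
     (\<forall>\<Omega>\<in>base X. \<forall>i. \<forall>c\<in>charts X. \<forall>p\<in>fst c. proj X p = \<Omega> \<and> p \<notin> range (\<alpha> \<Omega> i) \<longrightarrow>
        loop_integral X (\<lambda>d q. \<omega> c d p q) (\<alpha> \<Omega> i) = 0)"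

text \<open>\<open>\<nu> c p\<close> is the row vector \<open>[\<nu>\<^sub>1, \<nu>\<^sub>2]\<close> of the coefficients at \<open>p\<close>.  For \<open>p\<close> on \<open>\<beta>\<^sup>i\<close>, where the
  integral defining \<open>\<nu>\<^sub>i\<close> is singular, \<open>\<nu>\<^sub>i\<close> is determined by holomorphy.  The coefficients are
  holomorphic in the fibre coordinate and in \<open>\<Omega>\<close>, as is needed for the \<open>\<Omega>\<close>-derivatives of
  \<open>\<nu>\<close>, and the base coordinate \<open>\<Omega>\<close> is the period matrix of the marked surface over it.\<close>

definition normalised_differentials ::
    "'a surface_family \<Rightarrow> (complex^2^2 \<Rightarrow> 2 \<Rightarrow> real \<Rightarrow> 'a) \<Rightarrow> (complex^2^2 \<Rightarrow> 2 \<Rightarrow> real \<Rightarrow> 'a) \<Rightarrow>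
     'a bidifferential \<Rightarrow> ('a chart \<Rightarrow> 'a \<Rightarrow> complex^2) \<Rightarrow> bool" where
  "normalised_differentials X \<alpha> \<beta> \<omega> \<nu> \<longleftrightarrow>
     (\<forall>i. \<forall>c\<in>charts X. \<forall>d\<in>charts X. \<forall>p\<in>fst c \<inter> fst d.
        \<nu> c p $ i = \<nu> d p $ i * transition_deriv X c d p) \<and>
     (\<forall>i. \<forall>c\<in>charts X.
        holomorphic_sym_on (\<lambda>w. \<nu> c (chart_pt X c w) $ i) (coords X c ` fst c)) \<and>
     (\<forall>\<Omega>\<in>base X. \<forall>i. \<forall>c\<in>charts X. \<forall>p\<in>fst c. proj X p = \<Omega> \<and> p \<notin> range (\<beta> \<Omega> i) \<longrightarrow>
        \<nu> c p $ i = loop_integral X (\<lambda>d q. \<omega> c d p q) (\<beta> \<Omega> i)) \<and>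
     (\<forall>\<Omega>\<in>base X. \<forall>i j.
        loop_integral X (\<lambda>d q. \<nu> d q $ j) (\<alpha> \<Omega> i) = (if i = j then 2 * pi * \<i> else 0)) \<and>
     (\<forall>\<Omega>\<in>base X. \<forall>i j.
        \<Omega> $ i $ j = 1 / (2 * pi * \<i>) * loop_integral X (\<lambda>d q. \<nu> d q $ j) (\<beta> \<Omega> i))"


subsection \<open>The operator \<open>\<nabla>\<close> and the expression \<open>\<Psi>\<close>\<close>

text \<open>\<open>nabla X \<nu> c p d f q\<close> is the coefficient, for the chart \<open>c\<close> at the point \<open>p\<close>, of \<open>\<nabla>\<^sub>p f\<close> at \<open>q\<close>,
  with the coordinate of the chart \<open>d\<close> at \<open>q\<close> held fixed.\<close>

type_synonym 'a nabla_op = "'a chart \<Rightarrow> 'a \<Rightarrow> 'a chart \<Rightarrow> ('a \<Rightarrow> complex) \<Rightarrow> 'a \<Rightarrow> complex"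

definition nabla :: "'a surface_family \<Rightarrow> ('a chart \<Rightarrow> 'a \<Rightarrow> complex^2) \<Rightarrow> 'a nabla_op" where
  "nabla X \<nu> c p d f q = (\<Sum>(a, b)\<in>ordered_pairs. \<nu> c p $ a * \<nu> c p $ b * d_Omega X d a b f q)"

definition row_det :: "complex^2 \<Rightarrow> complex^2 \<Rightarrow> complex" where
  "row_det u v = det (vector [u, v] :: complex^2^2)"

definition wronskian :: "'a surface_family \<Rightarrow> ('a chart \<Rightarrow> 'a \<Rightarrow> complex^2) \<Rightarrow> 'a chart \<Rightarrow> 'a \<Rightarrow> complex" where
  "wronskian X \<nu> d q = row_det (\<nu> d q) (\<chi> j. d_coord X d (\<lambda>r. \<nu> d r $ j) q)"

text \<open>The coefficient of \<open>\<Psi>\<close> for the chart \<open>c\<close> at \<open>p\<close> and the chart \<open>d\<close> at \<open>q\<close>.  The operator \<open>D\<close>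
  in place of \<open>\<nabla>\<close> is an argument of its own because \<open>\<nabla>\<close>, unlike \<open>\<nu>\<close>, is unchanged under
  \<open>Sp(4, \<int>)\<close>.\<close>

definition Psi ::
    "'a surface_family \<Rightarrow> 'a bidifferential \<Rightarrow> ('a chart \<Rightarrow> 'a \<Rightarrow> complex^2) \<Rightarrow> 'a nabla_op \<Rightarrow>
     'a bidifferential" where
  "Psi X \<omega> \<nu> D c d p q =
     - (\<omega> c d p q * row_det (\<nu> c p) (\<nu> d q)
        + row_det (\<nu> d q) (\<chi> j. D c p d (\<lambda>r. \<nu> d r $ j) q))
     / wronskian X \<nu> d q"


subsection \<open>The action of \<open>Sp(4, \<int>)\<close>\<close>

text \<open>The \<open>4 \<times> 4\<close> matrix with blocks \<open>A, B, C, D\<close> is represented by the quadruple of its blocks.\<close>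

type_synonym block_matrix = "(int^2^2) \<times> (int^2^2) \<times> (int^2^2) \<times> (int^2^2)"

definition Sp4Z :: "block_matrix set" where
  "Sp4Z = {(A, B, C, D).
     transpose A ** D - transpose C ** B = mat 1 \<and>
     A ** transpose B = B ** transpose A \<and>
     C ** transpose D = D ** transpose C \<and>
     transpose A ** C = transpose C ** A \<and>
     transpose B ** D = transpose D ** B}"

fun automorphy :: "block_matrix \<Rightarrow> complex^2^2 \<Rightarrow> complex^2^2" where
  "automorphy (A, B, C, D) \<Omega> = map_matrix of_int C ** \<Omega> + map_matrix of_int D"

definition nu_tr ::
    "block_matrix \<Rightarrow> 'a surface_family \<Rightarrow> ('a chart \<Rightarrow> 'a \<Rightarrow> complex^2) \<Rightarrow> 'a chart \<Rightarrow> 'a \<Rightarrow> complex^2" where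
  "nu_tr \<gamma> X \<nu> c p = \<nu> c p v* matrix_inv (automorphy \<gamma> (proj X p))"

text \<open>The law \<open>\<nabla>\<^sub>x\<^sup>\<gamma> = \<nabla>\<^sub>x\<close>: the operator keeps its original coefficients and \<open>\<Omega>\<close>-derivatives.\<close>

definition nabla_tr :: "block_matrix \<Rightarrow> 'a surface_family \<Rightarrow> ('a chart \<Rightarrow> 'a \<Rightarrow> complex^2) \<Rightarrow> 'a nabla_op" where
  "nabla_tr \<gamma> X \<nu> = nabla X \<nu>"

text \<open>The derivative of \<open>log det M\<close> is written as a logarithmic derivative, which does not involve
  the choice of a branch of the logarithm.\<close>

definition pderiv_log_det :: "block_matrix \<Rightarrow> 2 \<Rightarrow> 2 \<Rightarrow> complex^2^2 \<Rightarrow> complex" where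
  "pderiv_log_det \<gamma> a b \<Omega> =
     pderiv_Omega a b (\<lambda>Z. det (automorphy \<gamma> Z)) \<Omega> / det (automorphy \<gamma> \<Omega>)"

definition omega_tr ::
    "block_matrix \<Rightarrow> 'a surface_family \<Rightarrow> ('a chart \<Rightarrow> 'a \<Rightarrow> complex^2) \<Rightarrow> 'a bidifferential \<Rightarrow>
     'a bidifferential" where
  "omega_tr \<gamma> X \<nu> \<omega> c d p q =
     \<omega> c d p q - 1 / 2 * (\<Sum>(a, b)\<in>ordered_pairs.
       (\<nu> c p $ a * \<nu> d q $ b + \<nu> c p $ b * \<nu> d q $ a) * pderiv_log_det \<gamma> a b (proj X p))"

end

theory Submission
  imports Defs
begin

text \<open>With \<open>M = C \<Omega> + D\<close>, \<open>N = M\<^sup>-\<^sup>1\<close> and \<open>S = N C\<close>, the symplectic relations make \<open>S\<close> symmetric.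
  Put \<open>s = \<nu>(y) S \<nu>(x)\<^sup>T\<close>.  As the logarithmic derivative of \<open>det M\<close> is the trace of \<open>N dM\<close>, the
  bidifferential becomes \<open>\<omega> - s\<close>; as \<open>dN = - N dM N\<close>, the vector \<open>\<nabla>\<^sub>x \<nu>(y)\<close> becomes
  \<open>\<nabla>\<^sub>x \<nu>(y) N - s \<nu>(x) N\<close>.  The two contributions of \<open>s\<close> to the numerator of \<open>\<Psi>\<close> cancel, and what
  remains of the numerator and the denominator is multiplied by the same factor \<open>det N\<close>.\<close>

unbundle no fps_syntax

section \<open>Inverses and determinants of 2x2 matrices\<close>

lemma matrix_inv_cancel:
  assumes "invertible A"
  shows "A ** matrix_inv A = mat 1" "matrix_inv A ** A = mat 1"
  using someI_ex[OF assms[unfolded invertible_def]] by (simp_all add: matrix_inv_def)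

definition adjugate2 :: "complex^2^2 \<Rightarrow> complex^2^2" where
  "adjugate2 A = (\<chi> i j. if i = j then (if i = 1 then A$2$2 else A$1$1) else - A$i$j)"

lemma adjugate2_nth [simp]:
  "adjugate2 A $1$1 = A$2$2" "adjugate2 A $2$2 = A$1$1"
  "adjugate2 A $1$2 = - A$1$2" "adjugate2 A $2$1 = - A$2$1"
  by (simp_all add: adjugate2_def)

text \<open>Cramer's rule turns the inverse into a quotient of explicit polynomials in the entries,
  to which the rules of differentiation apply.\<close>

lemma matrix_inv_2x2:
  assumes "det A \<noteq> 0"
  shows "matrix_inv A $ k $ l = adjugate2 A $ k $ l / det A"
proof -
  have "adjugate2 A ** A = (\<chi> i j. if i = j then det A else 0)"
    by (simp add: vec_eq_iff forall_2 matrix_matrix_mult_def sum_2 det_2 algebra_simps)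
  moreover have "A ** matrix_inv A = mat 1"
    using assms by (simp add: matrix_inv_cancel invertible_det_nz)
  ultimately have "adjugate2 A = (\<chi> i j. if i = j then det A else 0) ** matrix_inv A"
    by (metis matrix_mul_assoc matrix_mul_rid)
  also have "\<dots> $ k $ l = det A * matrix_inv A $ k $ l"
    by (simp add: matrix_matrix_mult_def if_distrib[where f = "\<lambda>x. x * _"] cong: if_cong)
  finally show ?thesis using assms by simp
qed

lemma row_det_altdef: "row_det u v = u$1 * v$2 - u$2 * v$1"
  by (simp add: row_det_def det_2 vector_2)

text \<open>This is multiplicativity of the determinant for the matrix with rows \<open>u\<close>
  and \<open>v\<close>. It is the source of the common factor \<open>det N\<close> in the numerator
  and denominator of \<open>Psi\<close>.\<close>

lemma row_det_vector_matrix_mult: "row_det (u v* N) (v v* N) = row_det u v * det N"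
  by (simp add: row_det_altdef det_2 vector_matrix_mult_def sum_2 algebra_simps)

section \<open>Curves in chart coordinates\<close>

text \<open>The derivative of \<open>f\<close> is taken within
  \<open>sym_mats \<times> UNIV\<close>, so the chain rule asks the curve to stay there. The
  derivative of the curve is complex linear in \<open>h\<close>, hence so is that of the composite.
  The case \<open>H = 0\<close>, \<open>k = 1\<close> serves \<open>d_coord\<close>; the case
  \<open>H = sym_unit a b\<close>, \<open>k = 0\<close> serves \<open>d_Omega\<close>.\<close>

lemma has_derivative_chart_curve:
  assumes hol: "holomorphic_sym_on f S" and S: "\<phi> t \<in> S"
    and \<phi>: "(\<phi> has_derivative (\<lambda>h. ((\<chi> i j. h * H$i$j), h * k))) (at t)"
    and sym: "\<And>h. fst (\<phi> h) \<in> sym_mats"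
  shows "(\<lambda>h. f (\<phi> h)) field_differentiable at t"
proof -
  obtain a b where
    "(f has_derivative (\<lambda>(H, k). (\<Sum>i\<in>UNIV. \<Sum>j\<in>UNIV. a $ i $ j * H $ i $ j) + b * k))
          (at (\<phi> t) within sym_mats \<times> UNIV)" (is "(f has_derivative ?L) _")
    using hol S unfolding holomorphic_sym_on_def by blast
  moreover have "range \<phi> \<subseteq> sym_mats \<times> UNIV"
    using sym by (simp add: image_subset_iff mem_Times_iff)
  ultimately have "(f has_derivative ?L) (at (\<phi> t) within range \<phi>)"
    by (rule has_derivative_subset)
  from has_derivative_in_compose[OF \<phi> this]
  have "((\<lambda>h. f (\<phi> h)) has_derivative (\<lambda>h. ?L ((\<chi> i j. h * H$i$j), h * k))) (at t)" .
  moreover have "(\<lambda>h. ?L ((\<chi> i j. h * H$i$j), h * k)) =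
      (*) ((\<Sum>i\<in>UNIV. \<Sum>j\<in>UNIV. a$i$j * H$i$j) + b * k)"
    by (rule ext) (simp add: sum_2 algebra_simps)
  ultimately show ?thesis
    unfolding field_differentiable_def has_field_derivative_def by metis
qed

lemma surface_family_chartD:
  assumes X: "genus2_family X" and d: "d \<in> charts X"
  shows "inj_on (coords X d) (fst d)"
    and "openin (top_of_set (sym_mats \<times> UNIV)) (coords X d ` fst d)"
    and "\<And>q. q \<in> fst d \<Longrightarrow> proj X q \<in> siegel2"
proof -
  have op: "openin (total_space X) (fst d)" using X d unfolding genus2_family_def by blast
  then have sub: "fst d \<subseteq> topspace (total_space X)" by (rule openin_subset)
  have "homeomorphic_map (subtopology (total_space X) (fst d)) (top_of_set (coords X d ` fst d))
          (coords X d)"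
    using X d unfolding genus2_family_def by blast
  from homeomorphic_imp_injective_map[OF this] show "inj_on (coords X d) (fst d)"
    using sub by (simp add: Int_absorb1)
  show "openin (top_of_set (sym_mats \<times> UNIV)) (coords X d ` fst d)"
    using X d unfolding genus2_family_def by blast
  have "continuous_map (total_space X) (top_of_set (base X)) (proj X)" "base X \<subseteq> siegel2"
    using X unfolding genus2_family_def by blast+
  then show "proj X q \<in> siegel2" if "q \<in> fst d" for q
    using that sub by (auto dest!: continuous_map_image_subset_topspace)
      (meson image_subset_iff subset_iff)
qed

lemma chart_pt_coords:
  assumes "genus2_family X" "d \<in> charts X" "q \<in> fst d"
  shows "chart_pt X d (coords X d q) = q"
  using surface_family_chartD(1)[OF assms(1,2)] assms(3) by (simp add: chart_pt_def inv_into_f_f)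

text \<open>\<open>chart_pt\<close> is known to invert \<open>coords\<close> only on the image of
  the chart; as that image is relatively open, the curve stays in it near \<open>t\<close>. Thus the
  factor in \<open>nu_tr\<close>, evaluated at the projection of the displaced point, becomes an
  explicit function along the curve.\<close>

lemma eventually_proj_chart_pt:
  assumes X: "genus2_family X" and d: "d \<in> charts X" and q: "q \<in> fst d"
    and cont: "isCont \<phi> t" and t: "\<phi> t = coords X d q"
    and sym: "\<And>h. fst (\<phi> h) \<in> sym_mats"
  shows "\<forall>\<^sub>F h in nhds t. proj X (chart_pt X d (\<phi> h)) = fst (\<phi> h)"
proof -
  obtain T where T: "open T" "coords X d ` fst d = (sym_mats \<times> UNIV) \<inter> T"
    using surface_family_chartD(2)[OF X d] unfolding openin_open by blast
  have "\<phi> t \<in> T" using T q t by blast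
  then have "\<forall>\<^sub>F h in nhds t. \<phi> h \<in> T"
    using cont T(1) by (simp add: isCont_def tendsto_at_iff_tendsto_nhds topological_tendstoD)
  then show ?thesis
  proof eventually_elim
    case (elim h)
    then have "\<phi> h \<in> coords X d ` fst d"
      unfolding T(2) using sym by (auto simp: mem_Times_iff)
    then have "coords X d (chart_pt X d (\<phi> h)) = \<phi> h"
      unfolding chart_pt_def by (rule f_inv_into_f)
    then show ?case by (metis coords_def fst_conv)
  qed
qed

section \<open>Invertibility of \<open>M\<close> on the Siegel upper half plane\<close>

text \<open>With \<open>P = A \<Omega> + B\<close> and \<open>M = C \<Omega> + D\<close> the relations defining the symplectic group give
  \<open>M\<^sup>* P - P\<^sup>* M = \<Omega> - \<Omega>\<^sup>*\<close>, which is \<open>2 \<i>\<close> times a positive definite matrix; a vector in the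
  kernel of \<open>M\<close> is therefore zero.\<close>

lemma det_automorphy_nonzero:
  assumes \<gamma>: "\<gamma> \<in> Sp4Z" and Z: "Z \<in> siegel2"
  shows "det (automorphy \<gamma> Z) \<noteq> 0"
proof
  assume det0: "det (automorphy \<gamma> Z) = 0"
  obtain A B C D where g: "\<gamma> = (A, B, C, D)" by (metis prod.exhaust)
  define M where "M = automorphy \<gamma> Z"
  have "\<not> inj ((*v) M)"
    using det0 unfolding M_def
    by (metis invertible_det_nz invertible_left_inverse matrix_left_invertible_injective)
  then obtain v where v: "v \<noteq> 0" "M *v v = 0"
    by (metis inj_def matrix_vector_mult_diff_distrib right_minus_eq)
  define c :: "int^2^2 \<Rightarrow> complex^2^2" where "c = map_matrix of_int"
  \<comment> \<open>The standard Hermitian form. Integer matrices being real, their adjoints for it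
    are their transposes.\<close>
  define ip :: "complex^2 \<Rightarrow> complex^2 \<Rightarrow> complex" where "ip u v = (\<Sum>j\<in>UNIV. cnj (u$j) * v$j)" for u v
  have ip: "ip (u + u') z = ip u z + ip u' z" "ip z (u + u') = ip z u + ip z u'" "ip 0 z = 0" "ip z 0 = 0"
    for u u' z
    by (simp_all add: ip_def sum_2 algebra_simps)
  have ip_adj: "ip (c F *v u) z = ip u (c (transpose F) *v z)" for F u z
    by (simp add: ip_def c_def map_matrix_def transpose_def matrix_vector_mult_def sum_2 algebra_simps)
  have c_hom: "c (F ** G) = c F ** c G" "c (F + G) = c F + c G" "c (mat 1) = mat 1" for F G
    by (simp_all add: c_def map_matrix_def matrix_matrix_mult_def vec_eq_iff mat_def)
  have rel: "transpose A ** D = transpose C ** B + mat 1" "transpose D ** A = transpose B ** C + mat 1"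
    "transpose C ** A = transpose A ** C" "transpose D ** B = transpose B ** D"
  proof -
    show "transpose A ** D = transpose C ** B + mat 1"
      using \<gamma> unfolding g Sp4Z_def by (auto simp: algebra_simps)
    from arg_cong[OF this, of transpose] show "transpose D ** A = transpose B ** C + mat 1"
      by (simp add: matrix_transpose_mul transpose_mat vec_eq_iff forall_2)
         (simp add: transpose_def matrix_matrix_mult_def sum_2 mat_def algebra_simps)
  qed (use \<gamma> in \<open>auto simp: g Sp4Z_def\<close>)
  define w where "w = Z *v v"
  define m where "m = c C *v w + c D *v v"
  define p where "p = c A *v w + c B *v v"
  have "m = M *v v"
    by (simp add: m_def M_def g w_def c_def matrix_vector_mul_assoc matrix_vector_mult_add_rdistrib)
  then have "m = 0" using v by simp
  \<comment> \<open>On expansion the terms pairing \<open>w\<close> with \<open>w\<close> and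
    \<open>v\<close> with \<open>v\<close> cancel; in the mixed terms only the summands
    \<open>mat 1\<close> of the relations survive. The left side is zero because \<open>m\<close>
    is.\<close>
  have "ip m p - ip p m = ip v w - ip w v"
    unfolding m_def p_def ip ip_adj matrix_vector_mul_assoc matrix_vector_right_distrib
    unfolding c_hom[symmetric] rel
    by (simp add: c_hom ip matrix_vector_mult_add_rdistrib)
  then have "(\<Sum>j\<in>UNIV. cnj (v$j) * w$j - cnj (w$j) * v$j) = 0"
    using \<open>m = 0\<close> by (simp add: ip) (simp add: ip_def sum_subtractf)
  then have "Im (\<Sum>j\<in>UNIV. cnj (v$j) * w$j - cnj (w$j) * v$j) = 0"
    by simp
  \<comment> \<open>Positivity in \<open>siegel2\<close> concerns real vectors, so \<open>v\<close>
    is split into real and imaginary parts; by the symmetry of \<open>Z\<close> the cross terms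
    between them cancel.\<close>
  moreover define x y where "x = (\<chi> i. Re (v$i))" and "y = (\<chi> i. Im (v$i))"
  define Q where "Q u = u \<bullet> (map_matrix Im Z *v u)" for u :: "real^2"
  have "Z$2$1 = Z$1$2"
    using Z unfolding siegel2_def sym_mats_def by (auto simp: vec_eq_iff transpose_def)
  then have "Im (\<Sum>j\<in>UNIV. cnj (v$j) * w$j - cnj (w$j) * v$j) = 2 * (Q x + Q y)"
    unfolding w_def Q_def x_def y_def
    by (simp add: matrix_vector_mult_def map_matrix_def inner_vec_def sum_2 algebra_simps)
  ultimately have Q0: "Q x + Q y = 0" by simp
  have Qpos: "u \<noteq> 0 \<Longrightarrow> Q u > 0" for u
    using Z unfolding siegel2_def Q_def by blast
  have "Q 0 = 0" by (simp add: Q_def)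
  have "x \<noteq> 0 \<or> y \<noteq> 0"
    using v(1) by (auto simp: x_def y_def vec_eq_iff complex_eq_iff)
  then show False
    using Q0 Qpos[of x] Qpos[of y] \<open>Q 0 = 0\<close> by (cases "x = 0"; cases "y = 0") auto
qed

section \<open>Determinant and inverse along a line of matrices\<close>

text \<open>In size 2 the determinant is exactly quadratic in \<open>h\<close>; the linear
  coefficient is Jacobi's formula for its derivative.\<close>

lemma det_matrix_line:
  fixes m K :: "complex^2^2"
  shows "det (\<chi> i j. m$i$j + h * K$i$j) = det m + h * trace (adjugate2 m ** K) + h\<^sup>2 * det K"
  by (simp add: det_2 trace_def matrix_matrix_mult_def sum_2 power2_eq_square algebra_simps)

lemma DERIV_det_line:
  fixes m K :: "complex^2^2"
  shows "((\<lambda>h. det (\<chi> i j. m$i$j + h * K$i$j)) has_field_derivative trace (adjugate2 m ** K)) (at 0)"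
  unfolding det_matrix_line by (auto intro!: derivative_eq_intros)

text \<open>The quotient rule is applied to adjugate over determinant. This yields differentiability
  along with the formula, whereas differentiating the identity between a matrix and its inverse
  would presuppose it.\<close>

lemma DERIV_matrix_inv_line:
  fixes m K :: "complex^2^2"
  assumes m: "det m \<noteq> 0"
  shows "((\<lambda>h. matrix_inv (\<chi> i j. m$i$j + h * K$i$j) $ k $ l)
           has_field_derivative - (matrix_inv m ** K ** matrix_inv m) $ k $ l) (at 0)"
proof -
  define G where "G h = (\<chi> i j. m$i$j + h * K$i$j)" for h
  have G0: "G 0 = m" by (simp add: G_def vec_eq_iff)
  have det: "((\<lambda>h. det (G h)) has_field_derivative trace (adjugate2 m ** K)) (at 0)"
    unfolding G_def by (rule DERIV_det_line)
  from DERIV_isCont[OF this] have "((\<lambda>h. det (G h)) \<longlongrightarrow> det (G 0)) (nhds 0)"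
    unfolding isCont_def by (rule tendsto_at_iff_tendsto_nhds[THEN iffD1])
  \<comment> \<open>Cramer's rule needs a nonzero determinant not just at 0 but for all
    \<open>h\<close> near 0, which continuity supplies.\<close>
  from tendsto_imp_eventually_ne[OF this, of 0] m
  have ev: "\<forall>\<^sub>F h in nhds 0. matrix_inv (G h) $ k $ l = adjugate2 (G h) $ k $ l / det (G h)"
    unfolding G0 by (auto elim!: eventually_mono simp: matrix_inv_2x2)
  have "adjugate2 (G h) $ k $ l = adjugate2 m $ k $ l + h * adjugate2 K $ k $ l" for h
    by (simp add: adjugate2_def G_def)
  then have adj: "((\<lambda>h. adjugate2 (G h) $ k $ l) has_field_derivative adjugate2 K $ k $ l) (at 0)"
    by (auto intro!: derivative_eq_intros)
  \<comment> \<open>The right side is the numerator of the quotient rule. The identity is polynomial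
    in the entries and is checked for each of the four positions.\<close>
  have "- (adjugate2 m ** K ** adjugate2 m) $ k $ l
      = adjugate2 K $ k $ l * det m - adjugate2 m $ k $ l * trace (adjugate2 m ** K)"
    by (rule disjE[OF exhaust_2[of k]]; rule disjE[OF exhaust_2[of l]])
       (simp_all add: matrix_matrix_mult_def sum_2 det_2 trace_def algebra_simps)
  moreover have "(matrix_inv m ** K ** matrix_inv m) $ k $ l
      = (adjugate2 m ** K ** adjugate2 m) $ k $ l / (det m * det m)"
    by (simp add: matrix_matrix_mult_def matrix_inv_2x2[OF m] sum_divide_distrib sum_distrib_right)
  ultimately have "- (matrix_inv m ** K ** matrix_inv m) $ k $ l
      = (adjugate2 K $ k $ l * det m - adjugate2 m $ k $ l * trace (adjugate2 m ** K)) / (det m * det m)"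
    by (metis minus_divide_left)
  then have "((\<lambda>h. adjugate2 (G h) $ k $ l / det (G h)) has_field_derivative
      - (matrix_inv m ** K ** matrix_inv m) $ k $ l) (at 0)"
    using DERIV_divide[OF adj det] m by (simp add: G0)
  then show ?thesis
    unfolding G_def[symmetric] by (rule DERIV_cong_ev[OF refl ev refl, THEN iffD2])
qed

lemma deriv_det_line:
  fixes m K :: "complex^2^2"
  assumes "det m \<noteq> 0"
  shows "deriv (\<lambda>h. det (\<chi> i j. m$i$j + h * K$i$j)) 0 / det m = trace (matrix_inv m ** K)"
  unfolding DERIV_imp_deriv[OF DERIV_det_line] trace_def
  by (simp add: matrix_matrix_mult_def matrix_inv_2x2[OF assms] sum_divide_distrib)

section \<open>The factor \<open>M\<close> and its derivatives in \<Omega>\<close>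

text \<open>The tangent direction of the coordinate \<open>\<Omega>\<^sub>a\<^sub>b\<close>. It is
  symmetric, so lines in this direction stay in \<open>sym_mats\<close>.\<close>

definition sym_unit :: "2 \<Rightarrow> 2 \<Rightarrow> complex^2^2" where
  "sym_unit a b = (\<chi> i j. if {i, j} = {a, b} then 1 else 0)"

lemma pderiv_Omega_altdef:
  "pderiv_Omega a b f Z = deriv (\<lambda>h. f (\<chi> i j. Z$i$j + h * sym_unit a b $i$j)) 0"
  unfolding pderiv_Omega_def sym_unit_def
  by (intro arg_cong2[where f = deriv] ext arg_cong[where f = f]) (auto simp: vec_eq_iff)

text \<open>The linear part of \<open>automorphy\<close> in \<Omega>, hence the block that governs
  all its \<Omega>-derivatives.\<close>

fun lower_left :: "block_matrix \<Rightarrow> complex^2^2" where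
  "lower_left (A, B, C, D) = map_matrix of_int C"

lemma automorphy_line:
  "automorphy \<gamma> (\<chi> i j. Z$i$j + h * E$i$j)
     = (\<chi> i j. automorphy \<gamma> Z $i$j + h * (lower_left \<gamma> ** E)$i$j)"
  by (cases \<gamma>) (simp add: vec_eq_iff matrix_matrix_mult_def sum_2 algebra_simps)

lemma pderiv_log_det_eq_trace:
  assumes "det (automorphy \<gamma> Z) \<noteq> 0"
  shows "pderiv_log_det \<gamma> a b Z = trace (matrix_inv (automorphy \<gamma> Z) ** lower_left \<gamma> ** sym_unit a b)"
  unfolding pderiv_log_det_def pderiv_Omega_altdef automorphy_line
  using deriv_det_line[OF assms] by (simp add: matrix_mul_assoc)

text \<open>For symmetric \<open>Z\<close> the relation
  \<open>C ** transpose D = D ** transpose C\<close> makes \<open>L ** transpose M\<close>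
  symmetric. Multiplying by \<open>N\<close> on the left and \<open>transpose N\<close> on the right
  gives the claim.\<close>

lemma transpose_matrix_inv_mult_lower_left:
  assumes \<gamma>: "\<gamma> \<in> Sp4Z" and Z: "Z \<in> sym_mats" and det: "det (automorphy \<gamma> Z) \<noteq> 0"
  shows "transpose (matrix_inv (automorphy \<gamma> Z) ** lower_left \<gamma>) = matrix_inv (automorphy \<gamma> Z) ** lower_left \<gamma>"
proof -
  obtain A B C D where g: "\<gamma> = (A, B, C, D)" by (metis prod.exhaust)
  define M L N where "M = automorphy \<gamma> Z" and "L = lower_left \<gamma>" and "N = matrix_inv M"
  have Z21: "Z$2$1 = Z$1$2"
    using Z unfolding sym_mats_def by (auto simp: vec_eq_iff transpose_def)
  have "C ** transpose D = D ** transpose C" using \<gamma> by (simp add: Sp4Z_def g)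
  \<comment> \<open>For a 2x2 matrix, symmetry amounts to this single off-diagonal equation.\<close>
  then have "complex_of_int ((C ** transpose D)$1$2) = complex_of_int ((D ** transpose C)$1$2)" by simp
  then have LM: "L ** transpose M = M ** transpose L"
    by (simp add: L_def M_def g vec_eq_iff forall_2 matrix_matrix_mult_def transpose_def sum_2 Z21 algebra_simps)
  have "invertible M" using det by (simp add: M_def invertible_det_nz)
  then have inv: "M ** N = mat 1" "N ** M = mat 1"
    unfolding N_def by (rule matrix_inv_cancel)+
  have "N ** L = N ** L ** transpose (N ** M)" by (simp add: inv transpose_mat)
  also have "\<dots> = N ** (L ** transpose M) ** transpose N"
    by (simp add: matrix_transpose_mul matrix_mul_assoc)
  also have "\<dots> = (N ** M) ** transpose L ** transpose N"
    unfolding LM by (simp add: matrix_mul_assoc)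
  finally have "N ** L = transpose L ** transpose N" by (simp add: inv)
  then show ?thesis
    unfolding M_def[symmetric] L_def[symmetric] N_def[symmetric] by (simp add: matrix_transpose_mul)
qed

section \<open>Derivatives of the transformed differentials\<close>

text \<open>The factor \<open>N\<close> depends on \<Omega> only, so it is constant along a fibre
  and passes through the derivative.\<close>

lemma d_coord_nu_tr:
  assumes X: "genus2_family X" and nu: "normalised_differentials X \<alpha> \<beta> \<omega> \<nu>"
    and d: "d \<in> charts X" and q: "q \<in> fst d"
  shows "(\<chi> j. d_coord X d (\<lambda>r. nu_tr \<gamma> X \<nu> d r $ j) q)
       = (\<chi> j. d_coord X d (\<lambda>r. \<nu> d r $ j) q) v* matrix_inv (automorphy \<gamma> (proj X q))"
proof -
  define \<phi> where "\<phi> s = (proj X q, s)" for s :: complex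
  define N where "N = matrix_inv (automorphy \<gamma> (proj X q))"
  have t: "\<phi> (snd d q) = coords X d q" by (simp add: \<phi>_def coords_def)
  have sym: "fst (\<phi> s) \<in> sym_mats" for s
    using surface_family_chartD(3)[OF X d q] by (simp add: \<phi>_def siegel2_def)
  have cont: "isCont \<phi> (snd d q)" unfolding \<phi>_def by (intro continuous_intros)
  have der: "(\<phi> has_derivative (\<lambda>h. ((\<chi> i j. h * (0::complex^2^2)$i$j), h * 1))) (at (snd d q))"
    unfolding \<phi>_def by (auto intro!: derivative_eq_intros simp: vec_eq_iff)
  have diff: "(\<lambda>s. \<nu> d (chart_pt X d (\<phi> s)) $ k) field_differentiable at (snd d q)" for k
    by (rule has_derivative_chart_curve[where f = "\<lambda>w. \<nu> d (chart_pt X d w) $ k" and S = "coords X d ` fst d", OF _ _ der sym])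
       (use nu d q t in \<open>auto simp: normalised_differentials_def\<close>)
  have "deriv (\<lambda>s. nu_tr \<gamma> X \<nu> d (chart_pt X d (\<phi> s)) $ j) (snd d q)
      = (\<Sum>k\<in>UNIV. deriv (\<lambda>s. \<nu> d (chart_pt X d (\<phi> s)) $ k) (snd d q) * N$k$j)" for j
  proof -
    have "deriv (\<lambda>s. nu_tr \<gamma> X \<nu> d (chart_pt X d (\<phi> s)) $ j) (snd d q)
       = deriv (\<lambda>s. \<Sum>k\<in>UNIV. \<nu> d (chart_pt X d (\<phi> s)) $ k * N$k$j) (snd d q)"
      by (rule deriv_cong_ev[OF eventually_mono[OF eventually_proj_chart_pt[OF X d q cont t sym]]])
         (simp_all add: nu_tr_def vector_matrix_mult_def N_def \<phi>_def mult.commute)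
    also have "\<dots> = (\<Sum>k\<in>UNIV. deriv (\<lambda>s. \<nu> d (chart_pt X d (\<phi> s)) $ k) (snd d q) * N$k$j)"
      by (intro DERIV_imp_deriv DERIV_sum DERIV_cmult_right
            diff[THEN field_differentiable_derivI])
    finally show ?thesis .
  qed
  then show ?thesis
    by (simp add: d_coord_def \<phi>_def N_def vec_eq_iff vector_matrix_mult_def mult.commute)
qed

text \<open>Here \<open>N\<close> moves with \<Omega>, and the product rule adds a term from its
  derivative.\<close>

lemma d_Omega_nu_tr:
  assumes X: "genus2_family X" and nu: "normalised_differentials X \<alpha> \<beta> \<omega> \<nu>"
    and \<gamma>: "\<gamma> \<in> Sp4Z" and d: "d \<in> charts X" and q: "q \<in> fst d"
    and N: "N = matrix_inv (automorphy \<gamma> (proj X q))"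
  shows "d_Omega X d a b (\<lambda>r. nu_tr \<gamma> X \<nu> d r $ j) q
       = (\<Sum>k\<in>UNIV. d_Omega X d a b (\<lambda>r. \<nu> d r $ k) q * N$k$j
            - \<nu> d q $ k * (N ** (lower_left \<gamma> ** sym_unit a b) ** N)$k$j)"
proof -
  define Z where "Z h = (\<chi> i j. proj X q$i$j + h * sym_unit a b$i$j)" for h
  define \<phi> where "\<phi> h = (Z h, snd d q)" for h
  have siegel: "proj X q \<in> siegel2" by (rule surface_family_chartD(3)[OF X d q])
  have "Z 0 = proj X q" by (simp add: Z_def vec_eq_iff)
  then have t: "\<phi> 0 = coords X d q" by (simp add: \<phi>_def coords_def)
  have sym: "fst (\<phi> s) \<in> sym_mats" for s
    using siegel
    by (simp add: \<phi>_def Z_def siegel2_def sym_mats_def transpose_def vec_eq_iff sym_unit_def insert_commute)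
  have "bounded_linear (\<lambda>h. \<chi> i j. h * sym_unit a b$i$j :: complex^2^2)"
    unfolding linear_conv_bounded_linear[symmetric]
    by (rule linearI) (simp_all add: vec_eq_iff algebra_simps)
  then have "((\<lambda>h. proj X q + (\<chi> i j. h * sym_unit a b$i$j)) has_derivative (\<lambda>h. \<chi> i j. h * sym_unit a b$i$j)) (at 0)"
    by (intro has_derivative_add[OF has_derivative_const, simplified] bounded_linear_imp_has_derivative)
  moreover have "Z = (\<lambda>h. proj X q + (\<chi> i j. h * sym_unit a b$i$j))"
    by (auto simp: Z_def vec_eq_iff)
  ultimately have der: "(\<phi> has_derivative (\<lambda>h. ((\<chi> i j. h * sym_unit a b$i$j), h * 0))) (at 0)"
    unfolding \<phi>_def by (simp add: has_derivative_Pair)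
  then have cont: "isCont \<phi> 0" by (rule has_derivative_continuous)
  have diff: "(\<lambda>s. \<nu> d (chart_pt X d (\<phi> s)) $ k) field_differentiable at 0" for k
    by (rule has_derivative_chart_curve[where f = "\<lambda>w. \<nu> d (chart_pt X d w) $ k" and S = "coords X d ` fst d", OF _ _ der sym])
       (use nu d q t in \<open>auto simp: normalised_differentials_def\<close>)
  have N_der: "((\<lambda>h. matrix_inv (automorphy \<gamma> (Z h)) $ k $ l) has_field_derivative
      - (N ** (lower_left \<gamma> ** sym_unit a b) ** N) $ k $ l) (at 0)" for k l
    unfolding Z_def automorphy_line N
    by (rule DERIV_matrix_inv_line[OF det_automorphy_nonzero[OF \<gamma> siegel]])
  have "deriv (\<lambda>s. nu_tr \<gamma> X \<nu> d (chart_pt X d (\<phi> s)) $ j) 0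
     = deriv (\<lambda>s. \<Sum>k\<in>UNIV. \<nu> d (chart_pt X d (\<phi> s)) $ k * matrix_inv (automorphy \<gamma> (Z s))$k$j) 0"
    by (rule deriv_cong_ev[OF eventually_mono[OF eventually_proj_chart_pt[OF X d q cont t sym]]])
       (simp_all add: nu_tr_def vector_matrix_mult_def \<phi>_def mult.commute)
  also have "\<dots> = (\<Sum>k\<in>UNIV. deriv (\<lambda>s. \<nu> d (chart_pt X d (\<phi> s)) $ k) 0 * N$k$j
      - \<nu> d q $ k * (N ** (lower_left \<gamma> ** sym_unit a b) ** N)$k$j)"
  proof -
    have "((\<lambda>s. \<Sum>k\<in>UNIV. \<nu> d (chart_pt X d (\<phi> s)) $ k * matrix_inv (automorphy \<gamma> (Z s))$k$j)
        has_field_derivative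
        (\<Sum>k\<in>UNIV. \<nu> d (chart_pt X d (\<phi> 0)) $ k * - (N ** (lower_left \<gamma> ** sym_unit a b) ** N)$k$j
           + deriv (\<lambda>s. \<nu> d (chart_pt X d (\<phi> s)) $ k) 0 * matrix_inv (automorphy \<gamma> (Z 0))$k$j)) (at 0)"
      by (intro DERIV_sum DERIV_mult' N_der diff[THEN field_differentiable_derivI])
    from DERIV_imp_deriv[OF this] show ?thesis
      by (simp add: t chart_pt_coords[OF X d q] N \<open>Z 0 = proj X q\<close>)
  qed
  finally show ?thesis
    by (simp add: d_Omega_def pderiv_Omega_altdef \<phi>_def Z_def)
qed

theorem theorem4p2:
  fixes X :: "'a surface_family"
    and \<alpha> \<beta> :: "complex^2^2 \<Rightarrow> 2 \<Rightarrow> real \<Rightarrow> 'a"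
    and \<omega> :: "'a bidifferential"
    and \<nu> :: "'a chart \<Rightarrow> 'a \<Rightarrow> complex^2"
    and \<gamma> :: block_matrix
  assumes "genus2_family X"
    and "marking X \<alpha> \<beta>"
    and "normalised_bidifferential X \<alpha> \<omega>"
    and "normalised_differentials X \<alpha> \<beta> \<omega> \<nu>"
    and "\<gamma> \<in> Sp4Z"
    and "c \<in> charts X" and "p \<in> fst c"
    and "d \<in> charts X" and "q \<in> fst d"
    and "proj X p = proj X q" and "p \<noteq> q"
    and "wronskian X \<nu> d q \<noteq> 0"
  shows "Psi X (omega_tr \<gamma> X \<nu> \<omega>) (nu_tr \<gamma> X \<nu>) (nabla_tr \<gamma> X \<nu>) c d p q
       = Psi X \<omega> \<nu> (nabla X \<nu>) c d p q"
proof -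
  define M N L S where "M = automorphy \<gamma> (proj X q)" and "N = matrix_inv M"
    and "L = lower_left \<gamma>" and "S = N ** L"
  define u v where "u = \<nu> c p" and "v = \<nu> d q"
  define s where "s = (\<Sum>k\<in>UNIV. (v v* S) $ k * u $ k)"
  define W where "W = (\<chi> j. nabla X \<nu> c p d (\<lambda>r. \<nu> d r $ j) q)"
  have siegel: "proj X q \<in> siegel2" by (rule surface_family_chartD(3)[OF assms(1,8,9)])
  have det: "det M \<noteq> 0"
    unfolding M_def by (rule det_automorphy_nonzero[OF assms(5) siegel])
  then have "invertible M" by (simp add: invertible_det_nz)
  then have "det (M ** N) = 1" unfolding N_def by (simp add: matrix_inv_cancel)
  then have "det N \<noteq> 0" by (auto simp: det_mul)
  have "proj X q \<in> sym_mats" using siegel by (simp add: siegel2_def)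
  from transpose_matrix_inv_mult_lower_left[OF assms(5) this det[unfolded M_def]]
  have "transpose S = S" unfolding S_def N_def M_def L_def .
  then have S21: "S$2$1 = S$1$2" by (auto simp: vec_eq_iff transpose_def)
  have tr: "nu_tr \<gamma> X \<nu> c p = u v* N" "nu_tr \<gamma> X \<nu> d q = v v* N"
    by (simp_all add: nu_tr_def u_def v_def N_def M_def assms(10))
  have wr: "wronskian X (nu_tr \<gamma> X \<nu>) d q = wronskian X \<nu> d q * det N"
    unfolding wronskian_def d_coord_nu_tr[OF assms(1,4,8,9)] tr
    by (simp add: row_det_vector_matrix_mult v_def N_def M_def)
  \<comment> \<open>The trace of \<open>S ** sym_unit a b\<close> is a diagonal entry of
    \<open>S\<close> for \<open>a = b\<close> and twice the off-diagonal entry otherwise. With the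
    factor 1/2 the sum is the full bilinear form \<open>s\<close>.\<close>
  have om: "omega_tr \<gamma> X \<nu> \<omega> c d p q = \<omega> c d p q - s"
    unfolding omega_tr_def assms(10) pderiv_log_det_eq_trace[OF det[unfolded M_def]]
      M_def[symmetric] N_def[symmetric] L_def[symmetric] S_def[symmetric] u_def[symmetric] v_def[symmetric]
    by (simp add: ordered_pairs_def s_def trace_def matrix_matrix_mult_def vector_matrix_mult_def sum_2
        sym_unit_def S21 doubleton_eq_iff field_simps)
  have "N ** (L ** E) ** N = S ** E ** N" for E by (simp add: S_def matrix_mul_assoc)
  note dO = d_Omega_nu_tr[OF assms(1,4,5,8,9) refl, folded M_def, folded N_def L_def v_def, unfolded this]
  \<comment> \<open>Summed over the ordered pairs, \<open>u$a * u$b\<close> times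
    \<open>sym_unit a b\<close> is the rank one matrix with entries \<open>u$i * u$j\<close>. Hence
    the derivative of \<open>N\<close> contributes \<open>s\<close> times
    \<open>u v* N\<close>.\<close>
  have na: "(\<chi> j. nabla X \<nu> c p d (\<lambda>r. nu_tr \<gamma> X \<nu> d r $ j) q) = W v* N - s *s (u v* N)"
    unfolding W_def nabla_def dO u_def[symmetric]
    by (simp add: ordered_pairs_def s_def matrix_matrix_mult_def vector_matrix_mult_def sum_2
        sym_unit_def S21 doubleton_eq_iff vec_eq_iff algebra_simps)
  have "row_det (v v* N) (W v* N - s *s (u v* N)) = det N * (row_det v W + s * row_det u v)"
  proof -
    \<comment> \<open>Antisymmetry of \<open>row_det\<close> reverses the sign of the
      \<open>s\<close> term, so that it cancels the one coming from \<open>omega_tr\<close>.\<close>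
    have "row_det (v v* N) (W v* N - s *s (u v* N))
        = row_det (v v* N) (W v* N) + s * row_det (u v* N) (v v* N)"
      by (simp add: row_det_altdef algebra_simps)
    then show ?thesis by (simp add: row_det_vector_matrix_mult algebra_simps)
  qed
  then have "(\<omega> c d p q - s) * row_det (u v* N) (v v* N) + row_det (v v* N) (W v* N - s *s (u v* N))
      = det N * (\<omega> c d p q * row_det u v + row_det v W)"
    by (simp add: row_det_vector_matrix_mult algebra_simps)
  then show ?thesis
    unfolding Psi_def nabla_tr_def na tr om wr
    using \<open>det N \<noteq> 0\<close> by (simp add: u_def v_def W_def minus_divide_left)
qed

end
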